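(* There is an absolute constant $c>0$ such that for every finite nonempty set $S\subset\mathbb{R}$ with $1+SS\subset\mathbb{R}_{>0}$ there exist $s,s'\in S$ such that $$\left|\frac{(1+sS)^{(2)}(1+s'S)^{(2)}}{(1+sS)^{(2)}(1+s'S)}\right|\ \ge\ c\,|S|^{31/12}.$$
   Context: For sets of real numbers, $UV=\{uv:u\in U,v\in V\}$; $1+SS=\{1+uv:u,v\in S\}$; $1+sS=\{1+su:u\in S\}$. $F^{(j)}$ denotes the $j$-fold product set $\{f_1\cdots f_j: f_i\in F\}$ with independent choices of the factors. The quotient set $U/V=\{u/v:u\in U,v\in V\}$ has independent numerator and denominator choices. Under the hypothesis all factors involved are positive, so no zero denominators occur. *)

theory Defs
  imports Complex_Main "HOL-Library.Set_Algebras"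
begin

text \<open>
  \<^theory>\<open>HOL-Library.Set_Algebras\<close> makes \<^typ>\<open>real set\<close> a multiplicative monoid under the product set
  \<open>U * V = {u * v | u \<in> U, v \<in> V}\<close>. So for a set \<open>F\<close> the power \<open>F ^ j\<close> is the \<open>j\<close>-fold product set
  \<open>{f\<^sub>1 \<cdots> f\<^sub>j | f\<^sub>i \<in> F}\<close> with independent factors (lemma \<open>set_power_2\<close>), not the set of
  \<open>j\<close>-th powers of elements of \<open>F\<close>. The dilate \<open>sS\<close> is \<open>s *o S\<close>, and \<open>1 + A\<close> is \<open>1 +o A\<close>.
\<close>

lemma set_power_2: "(F :: real set) ^ 2 = {f * g | f g. f \<in> F \<and> g \<in> F}"
  by (auto simp: power2_eq_square set_times_def)

definition quotient_set :: "real set \<Rightarrow> real set \<Rightarrow> real set"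
  where "quotient_set U V = {u / v | u v. u \<in> U \<and> v \<in> V}"

end

theory Submission
  imports Defs
begin

text \<open>
  After passing to \<open>-S\<close> if necessary, half of \<open>S\<close> is positive; order it as \<open>a\<^sub>0 < a\<^sub>1 < \<dots>\<close>.
  For consecutive elements \<open>s < s'\<close> put \<open>h(x) = (1 + s'x) / (1 + sx)\<close>, which is increasing, and
  consider the steps \<open>d\<^sub>k = h(a\<^sub>k\<^sub>+\<^sub>1) / h(a\<^sub>k)\<close>. These are cross ratios, and for fixed \<open>k < l\<close> the equality
  \<open>d\<^sub>k = d\<^sub>l\<close> says that a certain projective involution exchanges \<open>s\<close> and \<open>s'\<close>. The involution has
  only one fixed point in the relevant range, and it lies between \<open>s\<close> and \<open>s'\<close>, so at most one
  consecutive pair satisfies the equality. Averaging over the pairs, some pair has at least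
  half of its steps distinct.

  Squeezing: if \<open>d\<^sub>k \<le> d\<^sub>l\<close> then \<open>h(a\<^sub>l) d\<^sub>k\<close> lies in \<open>(h(a\<^sub>l), h(a\<^sub>l\<^sub>+\<^sub>1)]\<close>, which gives quadratically many
  values. If \<open>s'/s\<close> is at most \<open>c'/c\<close>, where \<open>c'\<close> is the successor of \<open>c\<close>, the intervals
  \<open>(1 + sc, 1 + s'c]\<close> are disjoint, and each contains \<open>(1 + sc) h(a\<^sub>l) d\<^sub>k\<close> for all these
  values with \<open>a\<^sub>l\<^sub>+\<^sub>1 \<le> c\<close>. All these products lie in the quotient set, whose cardinality is therefore
  at least a constant times the cube of \<open>|S|\<close>.
\<close>

section \<open>Shift ratios and their cross ratios\<close>

definition shift_ratio :: "real \<Rightarrow> real \<Rightarrow> real \<Rightarrow> real"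
  where "shift_ratio s s' x = (1 + s' * x) / (1 + s * x)"

text \<open>For positive arguments this is the cross ratio of \<open>s\<close>, \<open>s'\<close>,
  \<open>-1/x\<close>, \<open>-1/y\<close>.\<close>

definition shift_cross_ratio :: "real \<Rightarrow> real \<Rightarrow> real \<Rightarrow> real \<Rightarrow> real"
  where "shift_cross_ratio s s' x y = shift_ratio s s' y / shift_ratio s s' x"

lemma shift_ratio_pos:
  assumes "0 < s" "0 < s'" "0 < x"
  shows "0 < shift_ratio s s' x"
  using assms by (simp add: shift_ratio_def add_pos_pos)

lemma shift_ratio_strict_mono:
  assumes "0 < s" "s < s'" "0 < x" "x < y"
  shows "shift_ratio s s' x < shift_ratio s s' y"
proof -
  have "0 < (s' - s) * (y - x)" using assms by simp
  moreover have "0 < 1 + s * x" "0 < 1 + s * y" using assms by (simp_all add: add_pos_pos)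
  ultimately show ?thesis
    unfolding shift_ratio_def by (simp add: divide_simps) (simp add: algebra_simps)
qed

lemma shift_ratio_gt_1:
  assumes "0 < s" "s < s'" "0 < x"
  shows "1 < shift_ratio s s' x"
  using assms unfolding shift_ratio_def by (simp add: divide_simps add_pos_pos)

lemma shift_cross_ratio_gt_1:
  assumes "0 < s" "s < s'" "0 < x" "x < y"
  shows "1 < shift_cross_ratio s s' x y"
  using shift_ratio_strict_mono[OF assms] shift_ratio_pos[of s s' x] assms
  unfolding shift_cross_ratio_def by simp

text \<open>
  Equality of the two cross ratios says that \<open>s\<close> and \<open>s'\<close> are exchanged by the projective
  involution that exchanges \<open>-1/x\<close> with \<open>-1/v\<close> and \<open>-1/y\<close> with \<open>-1/u\<close>.
\<close>

lemma shift_cross_ratio_eqD: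
  assumes "0 < s" "s < s'" "0 < x" "0 < y" "0 < u" "0 < v"
    and eq: "shift_cross_ratio s s' x y = shift_cross_ratio s s' u v"
  shows "(y + u - x - v) + (y * u - x * v) * (s + s') +
    (y * u * (x + v) - x * v * (y + u)) * (s * s') = 0" (is "?Phi = 0")
proof -
  have pos: "1 + s * x \<noteq> 0" "1 + s * y \<noteq> 0" "1 + s * u \<noteq> 0" "1 + s * v \<noteq> 0"
    "1 + s' * x \<noteq> 0" "1 + s' * y \<noteq> 0" "1 + s' * u \<noteq> 0" "1 + s' * v \<noteq> 0"
    using assms by (smt (verit) mult_pos_pos)+
  have "(1 + s' * y) * (1 + s * x) * ((1 + s * v) * (1 + s' * u)) =
    (1 + s' * v) * (1 + s * u) * ((1 + s * y) * (1 + s' * x))"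
    using eq pos unfolding shift_cross_ratio_def shift_ratio_def
    by (simp add: frac_eq_eq mult_ac)
  then have "(s' - s) * ?Phi = 0" by algebra
  then show ?thesis using assms by simp
qed

text \<open>Two solutions give two linear relations between \<open>A\<close>, \<open>B\<close>,
  \<open>C\<close>. Elimination gives \<open>C\<close> the sign of \<open>A\<close> and
  \<open>B\<close> the opposite sign, so the quadratic with coefficients \<open>C\<close>,
  \<open>-2 * B\<close>, \<open>A\<close> cannot change sign on the positive reals. Yet its values
  at \<open>x\<close> and \<open>v\<close> have opposite signs.\<close>

lemma shift_cross_ratio_eq_once:
  assumes ord: "0 < x" "x < y" "y \<le> u" "u < v"
    and s: "0 < s1" "s1 < s1'" "s1' \<le> s2" "s2 < s2'"
    and eq1: "shift_cross_ratio s1 s1' x y = shift_cross_ratio s1 s1' u v"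
    and eq2: "shift_cross_ratio s2 s2' x y = shift_cross_ratio s2 s2' u v"
  shows False
proof -
  define A B C where "A = y * u * (x + v) - x * v * (y + u)"
    and "B = y * u - x * v" and "C = y + u - x - v"
  define p1 p2 t1 t2 where "p1 = s1 * s1'" and "p2 = s2 * s2'" and "t1 = s1 + s1'" and "t2 = s2 + s2'"
  have e1: "C + B * t1 + A * p1 = 0"
    unfolding A_def B_def C_def p1_def t1_def
    by (rule shift_cross_ratio_eqD) (use ord s eq1 in auto)
  have e2: "C + B * t2 + A * p2 = 0"
    unfolding A_def B_def C_def p2_def t2_def
    by (rule shift_cross_ratio_eqD) (use ord s eq2 in auto)
  have t: "0 < t2 - t1" using s unfolding t1_def t2_def by simp
  have p: "0 < p2 - p1" unfolding p1_def p2_def using s by (simp add: mult_strict_mono)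
  \<comment> \<open>The positivity derived here says that \<open>1/s + 1/s'\<close> decreases from
    the first pair to the second.\<close>
  have "t1 * p2 - t2 * p1 = s1 * s2 * (s2' - s1') + s1' * s2' * (s2 - s1)"
    unfolding p1_def p2_def t1_def t2_def by algebra
  moreover have "0 < s1 * s2 * (s2' - s1')" "0 < s1' * s2' * (s2 - s1)"
    using s by auto
  ultimately have q: "0 < t1 * p2 - t2 * p1" by linarith
  have B: "B * (t2 - t1) = - A * (p2 - p1)" using e1 e2 by algebra
  have C: "C * (t2 - t1) = A * (t1 * p2 - t2 * p1)" using e1 e2 by algebra
  \<comment> \<open>Nonzero roots \<open>z\<close> of this quadratic correspond to fixed points
    \<open>-1/z\<close> of the involution.\<close>
  have "C * x\<^sup>2 - 2 * B * x + A = (y - x) * (u - x) * (v - x)"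
    unfolding A_def B_def C_def by algebra
  then have Qx: "0 < C * x\<^sup>2 - 2 * B * x + A" using ord by simp
  have "C * v\<^sup>2 - 2 * B * v + A = - ((v - y) * (v - u) * (v - x))"
    unfolding A_def B_def C_def by algebra
  then have Qv: "C * v\<^sup>2 - 2 * B * v + A < 0" using ord by simp
  have vpos: "0 < v" using ord by simp
  show False
  proof (cases "0 \<le> A")
    case True
    have "B * (t2 - t1) \<le> 0" unfolding B using True p by simp
    then have "B * v \<le> 0" using t vpos by (simp add: mult_le_0_iff)
    moreover have "0 \<le> C * (t2 - t1)" unfolding C using True q by simp
    then have "0 \<le> C * v\<^sup>2" using t by (simp add: zero_le_mult_iff)
    ultimately show False using Qv True by linarith
  next
    case False
    have "0 \<le> B * (t2 - t1)" unfolding B using False p by (simp add: mult_le_0_iff)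
    then have "0 \<le> B * x" using t ord by (simp add: zero_le_mult_iff)
    moreover have "C * (t2 - t1) \<le> 0" unfolding C using False q by (simp add: mult_le_0_iff)
    then have "C * x\<^sup>2 \<le> 0" using t by (simp add: mult_le_0_iff)
    ultimately show False using Qx False by linarith
  qed
qed

section \<open>Selection and counting in finite sets\<close>

text \<open>Removing a minimiser of \<open>r\<close> again and again collects the \<open>m\<close>
  smallest values in \<open>I\<close>. With \<open>r\<close> the ratio of successive elements,
  \<open>I\<close> will supply the pairs \<open>s\<close>, \<open>s'\<close> and \<open>J\<close>
  the disjoint intervals.\<close>

lemma split_by_value:
  fixes r :: "'a \<Rightarrow> real"
  assumes "finite U" "card U = m + n"
  shows "\<exists>I J. I \<subseteq> U \<and> J \<subseteq> U \<and> card I = m \<and> card J = n \<and> (\<forall>i\<in>I. \<forall>j\<in>J. r i \<le> r j)"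
  using assms
proof (induction m arbitrary: U)
  case 0
  then show ?case by (intro exI[of _ "{}"] exI[of _ U]) auto
next
  case (Suc m)
  then have "U \<noteq> {}" by auto
  with Suc.prems obtain x where x: "x \<in> U" "\<forall>y\<in>U. r x \<le> r y"
    using ex_min_if_finite[of "r ` U"] by (metis (no_types) arg_min_if_finite(1,2) not_less)
  obtain I J where IJ: "I \<subseteq> U - {x}" "J \<subseteq> U - {x}" "card I = m" "card J = n"
    "\<forall>i\<in>I. \<forall>j\<in>J. r i \<le> r j"
    using Suc.IH[of "U - {x}"] Suc.prems x by auto
  have "finite I" using IJ(1) Suc.prems(1) by (meson finite_Diff finite_subset)
  then have "card (insert x I) = Suc m" using IJ by (subst card_insert_disjoint) auto
  then show ?case using IJ x
    by (intro exI[of _ "insert x I"] exI[of _ J]) auto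
qed

text \<open>The order is total, so each pair or its swap is counted.\<close>

lemma card_ordered_pairs_ge:
  fixes g :: "nat \<Rightarrow> real"
  assumes "finite L"
  shows "(card L)\<^sup>2 \<le> 2 * card {(k, l). k \<in> L \<and> l \<in> L \<and> g k \<le> g l}"
proof -
  let ?R = "{(k, l). k \<in> L \<and> l \<in> L \<and> g k \<le> g l}"
  have sub: "?R \<subseteq> L \<times> L" by auto
  then have fin: "finite ?R" using assms by (meson finite_SigmaI finite_subset)
  have "L \<times> L \<subseteq> ?R \<union> prod.swap ` ?R" by (force simp: image_iff)
  then have "card (L \<times> L) \<le> card (?R \<union> prod.swap ` ?R)"
    using fin by (intro card_mono) auto
  also have "\<dots> \<le> card ?R + card (prod.swap ` ?R)" by (rule card_Un_le)
  also have "\<dots> \<le> 2 * card ?R" using card_image_le[OF fin, of prod.swap] by simp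
  finally show ?thesis by (simp add: card_cartesian_product power2_eq_square)
qed

text \<open>By \<open>once\<close> the collision sets \<open>E i\<close> are disjoint, so together
  they have at most \<open>m * (m - 1) / 2\<close> elements, and some \<open>E i\<close> has at most
  \<open>m / 2\<close>. Deleting the larger index of each of its collisions leaves
  \<open>L\<close>.\<close>

lemma exists_nearly_injective:
  fixes g :: "'i \<Rightarrow> nat \<Rightarrow> real"
  assumes "finite I" "card I = m" "0 < m"
    and once: "\<And>i j k l. \<lbrakk>i \<in> I; j \<in> I; k < l; l < m; g i k = g i l; g j k = g j l\<rbrakk> \<Longrightarrow> i = j"
  shows "\<exists>i\<in>I. \<exists>L\<subseteq>{..<m}. inj_on (g i) L \<and> m \<le> 2 * card L"
proof -
  define E where "E i = {(k, l). k < l \<and> l < m \<and> g i k = g i l}" for i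
  let ?P = "{(k, l). k < l \<and> l < m}"
  have "?P = (\<lambda>(l, k). (k, l)) ` (SIGMA l:{..<m}. {..<l})" by force
  then have finP: "finite ?P" and "card ?P \<le> (\<Sum>l<m. l)"
    by (auto intro!: order_trans[OF card_image_le])
  then have cardP: "2 * card ?P \<le> m * m"
    using gauss_sum_nat[of "m - 1"] assms(3) lessThan_Suc_atMost[of "m - 1"]
    by (auto simp: atLeast0AtMost algebra_simps)
  have finE: "finite (E i)" for i
    by (rule finite_subset[OF _ finP]) (auto simp: E_def)
  have "(\<Sum>i\<in>I. card (E i)) = card (\<Union>i\<in>I. E i)"
    using assms(1) finE once by (intro card_UN_disjoint[symmetric]) (auto simp: E_def)
  also have "\<dots> \<le> card ?P" by (intro card_mono finP) (auto simp: E_def)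
  finally have sum_le: "2 * (\<Sum>i\<in>I. card (E i)) \<le> m * m" using cardP by linarith
  obtain i where i: "i \<in> I" "2 * card (E i) \<le> m"
  proof (rule ccontr)
    assume "\<not> thesis"
    with that have "\<forall>i\<in>I. m < 2 * card (E i)" by force
    then have "(\<Sum>i\<in>I. m) < (\<Sum>i\<in>I. 2 * card (E i))"
      using assms by (intro sum_strict_mono) auto
    then show False using sum_le assms(2) by (simp add: sum_distrib_left)
  qed
  define L where "L = {..<m} - snd ` E i"
  have "card (snd ` E i) \<le> card (E i)" by (rule card_image_le[OF finE])
  moreover have "m - card (snd ` E i) \<le> card L"
    unfolding L_def using diff_card_le_card_Diff[of "snd ` E i" "{..<m}"] finE by simp
  ultimately have "m \<le> 2 * card L" using i by linarith
  moreover have "inj_on (g i) L"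
  proof (rule linorder_inj_onI)
    fix k l assume "k < l" "k \<in> L" "l \<in> L"
    then show "g i k \<noteq> g i l" by (force simp: L_def E_def)
  qed auto
  ultimately show ?thesis using i(1) by (intro bexI[of _ i] exI[of _ L]) (auto simp: L_def)
qed

section \<open>Elements of the quotient set\<close>

text \<open>Written as one fraction, the product has two factors of each kind above, and two with
  \<open>s\<close> and one with \<open>s'\<close> below: exactly the available exponents.\<close>

lemma quotient_set_shifts_memI:
  assumes "a \<in> S" "b \<in> S" "k \<in> S" "k' \<in> S"
  shows "(1 + s * a) * (shift_ratio s s' b * shift_cross_ratio s s' k k') \<in>
    quotient_set ((1 +o (s *o S)) ^ 2 * (1 +o (s' *o S)) ^ 2)
      ((1 +o (s *o S)) ^ 2 * (1 +o (s' *o S)))"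
proof -
  have mem: "1 + r * x \<in> 1 +o (r *o S)" if "x \<in> S" for r x :: real
    using that by (auto intro!: set_plus_intro2 set_times_intro2)
  have "(1 + s * a) * (shift_ratio s s' b * shift_cross_ratio s s' k k') =
    ((1 + s * a) * (1 + s * k) * ((1 + s' * b) * (1 + s' * k'))) /
    ((1 + s * b) * (1 + s * k') * (1 + s' * k))"
    by (simp add: shift_ratio_def shift_cross_ratio_def mult_ac)
  then show ?thesis
    unfolding quotient_set_def power2_eq_square
    using assms by (blast intro: set_times_intro mem)
qed

lemma finite_quotient_set_shifts:
  assumes "finite S"
  shows "finite (quotient_set ((1 +o (s *o S)) ^ 2 * (1 +o (s' *o S)) ^ 2)
      ((1 +o (s *o S)) ^ 2 * (1 +o (s' *o S))))" (is "finite (quotient_set ?U ?V)")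
proof -
  have "finite (1 +o (r *o S))" for r :: real
    using assms by (simp add: elt_set_plus_def elt_set_times_def image_def[symmetric] setcompr_eq_image)
  then have "finite ?U" "finite ?V"
    by (auto simp: power2_eq_square intro!: finite_set_times)
  moreover have "quotient_set ?U ?V = (\<lambda>(u, v). u / v) ` (?U \<times> ?V)"
    by (auto simp: quotient_set_def)
  ultimately show ?thesis by simp
qed

section \<open>Cubically many distinct quotients\<close>

lemma cubic_bound_sequence:
  fixes a :: "nat \<Rightarrow> real"
  assumes mono: "\<And>i j. i < j \<Longrightarrow> j \<le> 3 * m \<Longrightarrow> a i < a j"
    and pos: "\<And>i. i \<le> 3 * m \<Longrightarrow> 0 < a i"
    and sub: "\<And>i. i \<le> 3 * m \<Longrightarrow> a i \<in> S"
    and "finite S" "0 < m"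
  shows "\<exists>s\<in>S. \<exists>s'\<in>S. m ^ 3 \<le> 8 * card (quotient_set
      ((1 +o (s *o S)) ^ 2 * (1 +o (s' *o S)) ^ 2)
      ((1 +o (s *o S)) ^ 2 * (1 +o (s' *o S))))"
proof -
  have mono_le: "a i \<le> a j" if "i \<le> j" "j \<le> 3 * m" for i j
    using that mono[of i j] by (cases "i = j") auto
  \<comment> \<open>Indices below \<open>m\<close> are reserved for \<open>k\<close> and
    \<open>l\<close>, so that \<open>Suc l\<close> \<le> \<open>c\<close> for all \<open>c\<close>
    in \<open>J\<close>; the \<open>2 * m\<close> indices above are shared between \<open>I\<close>
    and \<open>J\<close>.\<close>
  obtain I J where IJ: "I \<subseteq> {m..<3*m}" "J \<subseteq> {m..<3*m}" "card I = m" "card J = m"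
    and ratio: "\<And>i j. i \<in> I \<Longrightarrow> j \<in> J \<Longrightarrow> a (Suc i) / a i \<le> a (Suc j) / a j"
    using split_by_value[of "{m..<3*m}" m m "\<lambda>i. a (Suc i) / a i"] by auto
  define g where "g i k = shift_cross_ratio (a i) (a (Suc i)) (a k) (a (Suc k))" for i k
  have once: False if "i < j" "i \<in> I" "j \<in> I" "k < l" "l < m" "g i k = g i l" "g j k = g j l" for i j k l
    by (rule shift_cross_ratio_eq_once[of "a k" "a (Suc k)" "a l" "a (Suc l)"
          "a i" "a (Suc i)" "a j" "a (Suc j)"])
      (use that IJ in \<open>auto simp: g_def intro!: pos mono mono_le\<close>)
  have finI: "finite I" and finJ: "finite J"
    using IJ(1,2) by (auto intro: finite_subset)
  obtain i L where i: "i \<in> I" and L: "L \<subseteq> {..<m}" "inj_on (g i) L" "m \<le> 2 * card L"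
    using exists_nearly_injective[of I m g] IJ(3) finI \<open>0 < m\<close> once by (metis linorder_neqE_nat)
  have im: "m \<le> i" "i < 3 * m" using i IJ by auto
  define s s' where "s = a i" and "s' = a (Suc i)"
  have s: "0 < s" "s < s'" unfolding s_def s'_def using im by (auto intro!: pos mono)
  define h where "h = (\<lambda>l. shift_ratio s s' (a l))"
  define d where "d = g i"
  have h_pos: "0 < h l" if "l \<le> 3 * m" for l
    unfolding h_def using s that pos by (intro shift_ratio_pos) auto
  have h_mono: "h k < h l" if "k < l" "l \<le> 3 * m" for k l
    unfolding h_def using s that by (intro shift_ratio_strict_mono pos mono) auto
  have h_mono_le: "h k \<le> h l" if "k \<le> l" "l \<le> 3 * m" for k l
    using h_mono[of k l] that by (cases "k = l") auto
  have d_eq: "d k = h (Suc k) / h k" for k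
    by (simp add: d_def g_def h_def s_def s'_def shift_cross_ratio_def)
  have d_gt: "1 < d k" if "k < m" for k
    using h_mono[of k "Suc k"] h_pos[of k] that by (simp add: d_eq)
  let ?Q = "quotient_set ((1 +o (s *o S)) ^ 2 * (1 +o (s' *o S)) ^ 2)
      ((1 +o (s *o S)) ^ 2 * (1 +o (s' *o S)))"
  define R where "R = {(k, l). k \<in> L \<and> l \<in> L \<and> d k \<le> d l}"
  define w where "w = (\<lambda>(k, l). h l * d k)"
  have finL: "finite L" using L(1) finite_subset by blast
  have w_bounds: "h l < w (k, l)" "w (k, l) \<le> h (Suc l)" if "(k, l) \<in> R" for k l
  proof -
    have kl: "k < m" "l < m" "d k \<le> d l" using that L(1) by (auto simp: R_def)
    then have "0 < h l" by (simp add: h_pos)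
    then show "h l < w (k, l)" using d_gt[OF kl(1)] by (simp add: w_def)
    have "h l * d k \<le> h l * d l" using \<open>0 < h l\<close> kl by simp
    then show "w (k, l) \<le> h (Suc l)" using \<open>0 < h l\<close> by (simp add: w_def d_eq)
  qed
  \<comment> \<open>The intervals between successive values of \<open>h\<close> are disjoint, so the
    value of \<open>w\<close> determines \<open>l\<close>, then \<open>d k\<close>, and finally
    \<open>k\<close>.\<close>
  have w_inj: "inj_on w R"
  proof (rule inj_onI, clarify)
    fix k l k' l' assume R: "(k, l) \<in> R" "(k', l') \<in> R" and eq: "w (k, l) = w (k', l')"
    have lm: "l < m" "l' < m" using R L(1) by (auto simp: R_def)
    have "l = l'"
    proof (rule ccontr)
      assume "l \<noteq> l'"
      then have "h (Suc l) \<le> h l' \<or> h (Suc l') \<le> h l"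
        using h_mono_le lm by (metis Suc_leI less_imp_le_nat linorder_neqE_nat mult_le_mono1
            nat_mult_1 numeral_3_eq_3 order_trans le_add1 mult_Suc)
      then show False using w_bounds[OF R(1)] w_bounds[OF R(2)] eq by linarith
    qed
    moreover have "h l \<noteq> 0" using h_pos[of l] lm by auto
    ultimately have "d k = d k'" using eq by (simp add: w_def)
    then show "k = k' \<and> l = l'" using L(2) R \<open>l = l'\<close> by (auto simp: R_def d_def inj_on_def)
  qed
  \<comment> \<open>The factor \<open>h c\<close> turns \<open>1 + s * a c\<close> into
    \<open>1 + s' * a c\<close>, and \<open>ratio\<close> bounds \<open>s' * a c\<close> by
    \<open>s * a (Suc c)\<close>.\<close>
  have step: "(1 + s * a c) * h c \<le> 1 + s * a (Suc c)" if "c \<in> J" for c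
  proof -
    have c: "c < 3 * m" using that IJ by auto
    have "0 < a c" "0 < a i" using c im by (auto intro: pos)
    then have "s' * a c \<le> s * a (Suc c)"
      using ratio[OF i that] by (simp add: s_def s'_def field_simps)
    moreover have "1 + s * a c > 0" using s \<open>0 < a c\<close> by (simp add: add_pos_pos)
    ultimately show ?thesis by (simp add: h_def shift_ratio_def)
  qed
  define z where "z = (\<lambda>(c, r). (1 + s * a c) * w r)"
  have base_pos: "0 < 1 + s * a c" if "c \<le> 3 * m" for c
    using s pos[OF that] by (simp add: add_pos_pos)
  have z_bounds: "1 + s * a c < z (c, r)" "z (c, r) \<le> 1 + s * a (Suc c)" if "c \<in> J" "r \<in> R" for c r
  proof -
    obtain k l where r: "r = (k, l)" by force
    have kl: "k < m" "l < m" using that L(1) by (auto simp: R_def r)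
    have c: "m \<le> c" "c < 3 * m" using that IJ by auto
    have "1 < h l" unfolding h_def using s kl by (intro shift_ratio_gt_1 pos) auto
    then have "1 < w r" using w_bounds[of k l] that r by simp
    then show "1 + s * a c < z (c, r)" using base_pos[of c] c by (simp add: z_def)
    have "w r \<le> h c" using w_bounds[of k l] that r h_mono_le[of "Suc l" c] kl c by simp
    then have "z (c, r) \<le> (1 + s * a c) * h c" using base_pos[of c] c by (simp add: z_def)
    then show "z (c, r) \<le> 1 + s * a (Suc c)" using step[OF that(1)] by simp
  qed
  have z_inj: "inj_on z (J \<times> R)"
  proof (rule inj_onI, clarify)
    fix c k l c' k' l'
    assume c: "c \<in> J" "c' \<in> J" and R: "(k, l) \<in> R" "(k', l') \<in> R"
      and eq: "z (c, k, l) = z (c', k', l')"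
    have cm: "c < 3 * m" "c' < 3 * m" using c IJ by auto
    have "c = c'"
    proof (rule ccontr)
      assume "c \<noteq> c'"
      then have "a (Suc c) \<le> a c' \<or> a (Suc c') \<le> a c"
        using mono_le[of "Suc c" c'] mono_le[of "Suc c'" c] cm by linarith
      then have "s * a (Suc c) \<le> s * a c' \<or> s * a (Suc c') \<le> s * a c" using s by simp
      then show False using z_bounds[OF c(1) R(1)] z_bounds[OF c(2) R(2)] eq by linarith
    qed
    moreover have "1 + s * a c \<noteq> 0" using base_pos[of c] cm by simp
    ultimately have "w (k, l) = w (k', l')" using eq by (simp add: z_def)
    then show "c = c' \<and> (k, l) = (k', l')" using w_inj R \<open>c = c'\<close> by (auto simp: inj_on_def)
  qed
  have "z ` (J \<times> R) \<subseteq> ?Q"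
  proof clarify
    fix c k l assume c: "c \<in> J" and "(k, l) \<in> R"
    then have "k < m" "l < m" using L(1) by (auto simp: R_def)
    then show "z (c, k, l) \<in> ?Q"
      using quotient_set_shifts_memI[of "a c" S "a l" "a k" "a (Suc k)" s s'] c IJ(2) sub
      by (auto simp: z_def w_def h_def d_def g_def s_def s'_def)
  qed
  then have "card (z ` (J \<times> R)) \<le> card ?Q"
    by (intro card_mono finite_quotient_set_shifts \<open>finite S\<close>)
  then have mR: "m * card R \<le> card ?Q"
    using z_inj IJ(4) by (simp add: card_image card_cartesian_product)
  \<comment> \<open>\<open>L\<close> keeps half of the indices and \<open>R\<close> half of the
    pairs from \<open>L\<close>, whence the factor 8.\<close>
  have "m\<^sup>2 \<le> (2 * card L)\<^sup>2" using L(3) by (rule power_mono) simp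
  also have "\<dots> = 4 * (card L)\<^sup>2" by (simp add: power_mult_distrib)
  also have "\<dots> \<le> 8 * card R"
    using card_ordered_pairs_ge[OF finL, of d] by (simp add: R_def)
  finally have "m * m\<^sup>2 \<le> m * (8 * card R)" by (rule mult_left_mono) simp
  also have "m * m\<^sup>2 = m ^ 3" by (simp add: power2_eq_square power3_eq_cube)
  finally have "m ^ 3 \<le> 8 * card ?Q" using mR by linarith
  moreover have "s \<in> S" "s' \<in> S" using sub im by (auto simp: s_def s'_def)
  ultimately show ?thesis by blast
qed

section \<open>Reduction to positive elements\<close>

lemma cubic_bound_positive_part:
  fixes S :: "real set"
  assumes "finite S" "0 < m" "3 * m < card {x \<in> S. 0 < x}"
  shows "\<exists>s\<in>S. \<exists>s'\<in>S. m ^ 3 \<le> 8 * card (quotient_set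
      ((1 +o (s *o S)) ^ 2 * (1 +o (s' *o S)) ^ 2)
      ((1 +o (s *o S)) ^ 2 * (1 +o (s' *o S))))"
proof -
  let ?P = "{x \<in> S. 0 < x}"
  define xs where "xs = sorted_list_of_set ?P"
  have len: "length xs = card ?P" by (simp add: xs_def)
  have set: "set xs = ?P" using assms(1) by (simp add: xs_def)
  have mem: "xs ! i \<in> ?P" if "i \<le> 3 * m" for i
    using that assms(3) len set nth_mem[of i xs] by auto
  show ?thesis
  proof (rule cubic_bound_sequence[of m "\<lambda>i. xs ! i"])
    fix i j assume "i < j" "j \<le> 3 * m"
    then show "xs ! i < xs ! j"
      using strict_sorted_list_of_set[of ?P] assms(3) len
      by (intro sorted_wrt_nth_less[of "(<)"]) (auto simp: xs_def)
  qed (use mem assms in auto)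
qed

text \<open>Negating both \<open>s\<close> and \<open>S\<close> preserves \<open>s *o S\<close>, so
  the more frequent sign may be taken positive. The extra 1 in \<open>6 * m + 1\<close> allows for a
  zero in \<open>S\<close>.\<close>

lemma cubic_bound:
  fixes S :: "real set"
  assumes "finite S" "0 < m" "6 * m + 1 < card S"
  shows "\<exists>s\<in>S. \<exists>s'\<in>S. m ^ 3 \<le> 8 * card (quotient_set
      ((1 +o (s *o S)) ^ 2 * (1 +o (s' *o S)) ^ 2)
      ((1 +o (s *o S)) ^ 2 * (1 +o (s' *o S))))"
proof -
  let ?N = "uminus ` S"
  have neg: "{x \<in> ?N. 0 < x} = uminus ` {x \<in> S. x < 0}" by force
  have "S \<subseteq> insert 0 ({x \<in> S. 0 < x} \<union> {x \<in> S. x < 0})" by auto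
  then have "card S \<le> card (insert 0 ({x \<in> S. 0 < x} \<union> {x \<in> S. x < 0}))"
    using assms(1) by (intro card_mono) auto
  also have "\<dots> \<le> Suc (card ({x \<in> S. 0 < x} \<union> {x \<in> S. x < 0}))"
    using assms(1) by (simp add: card_insert_if)
  also have "\<dots> \<le> Suc (card {x \<in> S. 0 < x} + card {x \<in> S. x < 0})" by (simp add: card_Un_le)
  also have "card {x \<in> S. x < 0} = card {x \<in> ?N. 0 < x}"
    unfolding neg by (simp add: card_image)
  finally consider "3 * m < card {x \<in> S. 0 < x}" | "3 * m < card {x \<in> ?N. 0 < x}"
    using assms(3) by linarith
  then show ?thesis
  proof cases
    case 1
    then show ?thesis using cubic_bound_positive_part assms by blast
  next
    case 2
    have dil: "(- s) *o ?N = s *o S" for s :: real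
      by (force simp: elt_set_times_def)
    show ?thesis
      using cubic_bound_positive_part[of ?N m] 2 assms by (simp add: dil bex_simps)
  qed
qed

theorem theorem1p2:
  shows "\<exists>c::real. c > 0 \<and>
    (\<forall>S::real set. finite S \<longrightarrow> S \<noteq> {} \<longrightarrow> 1 +o (S * S) \<subseteq> {0<..} \<longrightarrow>
      (\<exists>s\<in>S. \<exists>s'\<in>S.
        real (card (quotient_set
          ((1 +o (s *o S)) ^ 2 * (1 +o (s' *o S)) ^ 2)
          ((1 +o (s *o S)) ^ 2 * (1 +o (s' *o S)))))
        \<ge> c * real (card S) powr (31 / 12)))"
proof (intro exI[of _ "1 / (8 * 14 ^ 3)"] conjI allI impI)
  fix S :: "real set"
  assume S: "finite S" "S \<noteq> {}"
  let ?Q = "\<lambda>s s'. quotient_set ((1 +o (s *o S)) ^ 2 * (1 +o (s' *o S)) ^ 2)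
      ((1 +o (s *o S)) ^ 2 * (1 +o (s' *o S)))"
  define n where "n = card S"
  \<comment> \<open>For positive \<open>m\<close> this gives \<open>n\<close> \<le>
    \<open>6 * m + 7\<close> \<le> \<open>14 * m\<close>; for \<open>m = 0\<close>, \<open>n\<close>
    is bounded and a nonempty quotient set suffices.\<close>
  define m where "m = (n - 2) div 6"
  have n: "1 \<le> n" using S by (simp add: n_def Suc_leI card_gt_0_iff)
  have "\<exists>s\<in>S. \<exists>s'\<in>S. n ^ 3 \<le> 8 * 14 ^ 3 * card (?Q s s')"
  proof (cases "m = 0")
    case True
    obtain x where x: "x \<in> S" using S by blast
    have "?Q x x \<noteq> {}" using quotient_set_shifts_memI[OF x x x x] by blast
    then have "1 \<le> card (?Q x x)"
      using finite_quotient_set_shifts[OF S(1), of x x] by (metis One_nat_def Suc_leI card_gt_0_iff)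
    moreover have "n \<le> 14" using True by (simp add: m_def)
    then have "n ^ 3 \<le> 14 ^ 3" by (rule power_mono) simp
    ultimately show ?thesis using x by (intro bexI[of _ x]) auto
  next
    case False
    then have m: "6 * m + 1 < card S" "n \<le> 14 * m" by (auto simp: m_def n_def)
    obtain s s' where s: "s \<in> S" "s' \<in> S" "m ^ 3 \<le> 8 * card (?Q s s')"
      using cubic_bound[of S m] S m False by blast
    have "n ^ 3 \<le> (14 * m) ^ 3" using m(2) by (rule power_mono) simp
    also have "\<dots> = 14 ^ 3 * m ^ 3" by (simp add: power_mult_distrib)
    also have "\<dots> \<le> 8 * 14 ^ 3 * card (?Q s s')" using s(3) by simp
    finally show ?thesis using s(1,2) by blast
  qed
  then obtain s s' where s: "s \<in> S" "s' \<in> S" "n ^ 3 \<le> 8 * 14 ^ 3 * card (?Q s s')" by blast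
  \<comment> \<open>The cubic bound exceeds the required one, since \<open>31 / 12 < 3\<close> and
    \<open>n\<close> is at least 1.\<close>
  have "real n powr (31 / 12) \<le> real n powr 3" using n by (intro powr_mono) auto
  also have "\<dots> = real (n ^ 3)" using n by simp
  also have "\<dots> \<le> real (8 * 14 ^ 3 * card (?Q s s'))" using s(3) by (rule of_nat_mono)
  finally have "1 / (8 * 14 ^ 3) * real n powr (31 / 12) \<le> real (card (?Q s s'))" by simp
  then show "\<exists>s\<in>S. \<exists>s'\<in>S. 1 / (8 * 14 ^ 3) * real (card S) powr (31 / 12) \<le> real (card (?Q s s'))"
    using s(1,2) unfolding n_def by blast
qed simp

end
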